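(* Let $p\ge2$ and $m\ge0$ be integers. Then \begin{align*} &(-1)^{p-1}\{S(2,p+2m+1;p)+S(2,p;p+2m+1)\}\\ &=\sum_{i=1}^{p+2m}\sum_{j=1}^{p+2m+1-i}(-1)^{i+j}\zeta(p+2m+3-i-j)S(p;i+j)-\sum_{i=1}^{p-1}\sum_{j=1}^{p-i}(-1)^{i+j}\zeta(p+2-i-j)S(p+2m+1;i+j)\\ &\quad-(-1)^p\zeta(2)\{\zeta(p)\zeta(p+2m+1)+\zeta(2p+2m+1)\}\\ &\quad+(-1)^p(p+2m+1)S(1,p;p+2m+2)+(-1)^p p\,S(1,p+2m+1;p+1). \end{align*}
   Context: For positive integers $k,n$, $\zeta_n(k)=\sum_{j=1}^n j^{-k}$, $H_n=\zeta_n(1)$, and $\zeta(s)=\sum_{n\ge1}n^{-s}$. For positive integers $a,b,q$ with $q\ge2$: $S(a;q)=\sum_{n\ge1}\zeta_n(a)n^{-q}$ and $S(a,b;q)=\sum_{n\ge1}\zeta_n(a)\zeta_n(b)n^{-q}$. *)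

theory Defs
  imports "HOL-Analysis.Analysis"
begin

definition zeta_partial :: "nat \<Rightarrow> nat \<Rightarrow> real" where
  "zeta_partial n k = (\<Sum>j=1..n. 1 / real j ^ k)"

text \<open>The infinite sums over \<open>n \<ge> 1\<close> are indexed from 0 via \<^const>\<open>Suc\<close>; they converge
  for \<open>s \<ge> 2\<close> and \<open>q \<ge> 2\<close>, the only arguments for which they are meaningful.\<close>

definition zeta :: "nat \<Rightarrow> real" where
  "zeta s = (\<Sum>n. 1 / real (Suc n) ^ s)"

definition euler_sum1 :: "nat \<Rightarrow> nat \<Rightarrow> real" where
  "euler_sum1 a q = (\<Sum>n. zeta_partial (Suc n) a / real (Suc n) ^ q)"

definition euler_sum2 :: "nat \<Rightarrow> nat \<Rightarrow> nat \<Rightarrow> real" where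
  "euler_sum2 a b q =
     (\<Sum>n. zeta_partial (Suc n) a * zeta_partial (Suc n) b / real (Suc n) ^ q)"

end

theory Submission
  imports Defs
begin

text \<open>Put $q = p + 2m + 1$ and $F_a(n) = \sum_{k \ge 1} k^{-a} (k+n)^{-2}$. With $N = n + k$,
  the sum $\sum_n \zeta_n(a) F_b(n)$ equals $\sum_{j,k \ge 1} \sum_{N \ge j+k} j^{-a} k^{-b} N^{-2}$,
  which is symmetric in $a$ and $b$. On the other hand the partial fraction
  decomposition of $x^{-a} (x+n)^{-2}$ expresses $F_a(n)$ through $\zeta_n(2)$, $H_n$ and zeta
  values. Inserting this into $\sum_n \zeta_n(p) F_q(n) = \sum_n \zeta_n(q) F_p(n)$ gives the
  identity; as $p$ and $q$ have opposite parity, the terms $S(p;q)$ and $S(q;p)$ occur with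
  the same sign, and their sum is $\zeta(p) \zeta(q) + \zeta(p+q)$.\<close>

lemma sum_triangle_by_diagonals:
  fixes g :: "nat \<Rightarrow> 'a::semiring_1"
  shows "(\<Sum>i = 1..n - 1. \<Sum>j = 1..n - i. g (i + j)) = (\<Sum>s = 2..n. of_nat (s - 1) * g s)"
proof -
  have "(\<Sum>i = 1..n - 1. \<Sum>j = 1..n - i. g (i + j)) = (\<Sum>s = 2..n. \<Sum>i = 1..s - 1. g s)"
    unfolding sum.Sigma[OF finite_atLeastAtMost ballI[OF finite_atLeastAtMost]]
    by (rule sum.reindex_bij_witness[of _ "\<lambda>(s, i). (i, s - i)" "\<lambda>(i, j). (i + j, i)"]) auto
  thus ?thesis by simp
qed

lemma sum_partial_sums_reflection:
  fixes f g :: "nat \<Rightarrow> 'a::comm_semiring_0"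
  shows "(\<Sum>n<N. (\<Sum>k\<le>n. f k) * g n) + (\<Sum>n<N. (\<Sum>k\<le>n. g k) * f n)
    = (\<Sum>n<N. f n) * (\<Sum>n<N. g n) + (\<Sum>n<N. f n * g n)"
  by (induction N) (simp_all add: lessThan_Suc_atMost[symmetric] algebra_simps)

lemma shifted_telescope_sums:
  fixes f :: "nat \<Rightarrow> 'a::real_normed_vector"
  assumes "f \<longlonglongrightarrow> 0"
  shows "(\<lambda>k. f k - f (k + n)) sums (\<Sum>k<n. f k)"
proof (induction n)
  case (Suc n)
  have "(\<lambda>k. f (k + n) - f (Suc k + n)) sums (f (0 + n) - 0)"
    using LIMSEQ_ignore_initial_segment[OF assms] by (rule telescope_sums')
  from sums_add[OF Suc.IH this] show ?case by simp
qed simp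

lemma has_sum_Sigma_nonneg_iff:
  fixes f :: "'a \<times> 'b \<Rightarrow> real"
  assumes row: "\<And>x. x \<in> A \<Longrightarrow> ((\<lambda>y. f (x, y)) has_sum g x) (B x)"
    and nonneg: "\<And>x y. x \<in> A \<Longrightarrow> y \<in> B x \<Longrightarrow> f (x, y) \<ge> 0"
  shows "(f has_sum s) (Sigma A B) \<longleftrightarrow> (g has_sum s) A"
proof
  assume "(f has_sum s) (Sigma A B)"
  thus "(g has_sum s) A" using row by (rule has_sum_SigmaD)
next
  assume total: "(g has_sum s) A"
  show "(f has_sum s) (Sigma A B)"
    using row total summable_on_SigmaI[OF row has_sum_imp_summable[OF total] nonneg]
    by (rule has_sum_SigmaI)
qed

lemma sums_partial_sum_times_shifted_suminf_iff_has_sum: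
  fixes u v w :: "nat \<Rightarrow> real"
  assumes nonneg: "\<And>n. u n \<ge> 0" "\<And>n. v n \<ge> 0" "\<And>n. w n \<ge> 0"
    and summable: "\<And>n. summable (\<lambda>k. v k * w (n + k))"
  shows "(\<lambda>n. (\<Sum>j\<le>n. u j) * (\<Sum>k. v k * w (n + k))) sums s
    \<longleftrightarrow> ((\<lambda>(j, k, d). u j * v k * w (j + k + d)) has_sum s) UNIV"
proof -
  define U where "U n = (\<Sum>j\<le>n. u j)" for n
  define V where "V n = (\<Sum>k. v k * w (n + k))" for n
  define summand where "summand = (\<lambda>(n, j, k). u j * (v k * w (n + k)))"
  define triples where "triples = (SIGMA n:(UNIV :: nat set). {..n} \<times> (UNIV :: nat set))"
  have tail: "((\<lambda>k. v k * w (n + k)) has_sum V n) UNIV" for n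
    using summable unfolding V_def
    by (intro sums_nonneg_imp_has_sum summable_sums) (simp_all add: nonneg)
  have row: "((\<lambda>y. summand (n, y)) has_sum (U n * V n)) ({..n} \<times> UNIV)" for n
  proof (rule has_sum_Sigma_nonneg_iff[THEN iffD2])
    show "((\<lambda>k. summand (n, j, k)) has_sum (u j * V n)) UNIV" for j
      using has_sum_cmult_right[OF tail] by (simp add: summand_def)
    show "((\<lambda>j. u j * V n) has_sum (U n * V n)) {..n}"
      by (rule has_sum_finiteI) (simp_all add: U_def sum_distrib_right)
  qed (simp add: summand_def nonneg)
  have "(\<lambda>n. U n * V n) sums s \<longleftrightarrow> ((\<lambda>n. U n * V n) has_sum s) UNIV"
    using nonneg summable
    by (auto intro!: sums_nonneg_imp_has_sum has_sum_imp_sums mult_nonneg_nonneg sum_nonneg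
        suminf_nonneg simp: U_def V_def)
  also have "\<dots> \<longleftrightarrow> (summand has_sum s) triples"
    unfolding triples_def
    by (rule has_sum_Sigma_nonneg_iff[OF row, symmetric]) (auto simp: summand_def nonneg)
  also have "\<dots> \<longleftrightarrow> ((\<lambda>(j, k, d). u j * v k * w (j + k + d)) has_sum s) UNIV"
    by (rule has_sum_reindex_bij_witness[of _ "\<lambda>(j, k, d). (j + d, j, k)" "\<lambda>(n, j, k). (j, k, n - j)"])
      (auto simp: triples_def summand_def add_ac)
  finally show ?thesis by (simp add: U_def V_def)
qed

lemma sums_partial_sum_times_shifted_suminf_swap:
  fixes u v w :: "nat \<Rightarrow> real"
  assumes nonneg: "\<And>n. u n \<ge> 0" "\<And>n. v n \<ge> 0" "\<And>n. w n \<ge> 0"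
    and summable: "\<And>n. summable (\<lambda>k. u k * w (n + k))" "\<And>n. summable (\<lambda>k. v k * w (n + k))"
  shows "(\<lambda>n. (\<Sum>j\<le>n. u j) * (\<Sum>k. v k * w (n + k))) sums s
    \<longleftrightarrow> (\<lambda>n. (\<Sum>j\<le>n. v j) * (\<Sum>k. u k * w (n + k))) sums s"
proof -
  have "((\<lambda>(j, k, d). u j * v k * w (j + k + d)) has_sum s) UNIV
      \<longleftrightarrow> ((\<lambda>(j, k, d). v j * u k * w (j + k + d)) has_sum s) UNIV"
    by (rule has_sum_reindex_bij_witness[of _ "\<lambda>(j, k, d). (k, j, d)" "\<lambda>(j, k, d). (k, j, d)"])
      (auto simp: mult_ac add_ac)
  thus ?thesis
    by (simp add: sums_partial_sum_times_shifted_suminf_iff_has_sum nonneg summable)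
qed

lemma zeta_partial_altdef: "zeta_partial n a = (\<Sum>k<n. 1 / real (Suc k) ^ a)"
  by (simp add: zeta_partial_def sum.atLeast1_atMost_eq)

lemma zeta_sums:
  assumes "s \<ge> 2"
  shows "(\<lambda>n. 1 / real (Suc n) ^ s) sums zeta s"
proof -
  have "summable (\<lambda>n. inverse (real (Suc n) ^ s))"
    using inverse_power_summable[OF assms, where 'a = real] by (subst summable_Suc_iff)
  thus ?thesis
    by (simp add: zeta_def summable_sums inverse_eq_divide)
qed

lemma zeta_tail_sums:
  assumes "s \<ge> 2"
  shows "(\<lambda>k. 1 / (real (Suc k) + real n) ^ s) sums (zeta s - zeta_partial n s)"
  using sums_split_initial_segment[OF zeta_sums[OF assms], of n]
  by (simp add: zeta_partial_altdef algebra_simps)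

lemma harmonic_telescope_sums:
  "(\<lambda>k. 1 / real (Suc k) - 1 / (real (Suc k) + real n)) sums zeta_partial n 1"
  using shifted_telescope_sums[OF LIMSEQ_inverse_real_of_nat, of n]
  by (simp add: zeta_partial_altdef inverse_eq_divide algebra_simps)

lemma zeta_partial_le_ln:
  assumes "a \<ge> 1" "n > 0"
  shows "zeta_partial n a \<le> 1 + ln (real n)"
proof -
  have "zeta_partial n a \<le> harm n"
    unfolding zeta_partial_def harm_def using assms(1)
    by (intro sum_mono) (auto simp: inverse_eq_divide intro!: divide_left_mono self_le_power)
  also have "\<dots> \<le> 1 + ln (real n)"
    using euler_mascheroni_sequence_decreasing[of 1 n] assms(2) by (simp add: harm_expand)
  finally show ?thesis .
qed

lemma zeta_partial_bigo:
  assumes "a \<ge> 1" "e > 0"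
  shows "(\<lambda>n. zeta_partial (Suc n) a) \<in> O(\<lambda>n. real n powr e)"
proof -
  have "(\<lambda>n. zeta_partial (Suc n) a) \<in> O(\<lambda>n. 1 + ln (real (Suc n)))"
  proof (intro landau_o.big_mono always_eventually allI)
    fix n
    have "zeta_partial (Suc n) a \<ge> 0"
      unfolding zeta_partial_def by (intro sum_nonneg) simp
    thus "norm (zeta_partial (Suc n) a) \<le> norm (1 + ln (real (Suc n)))"
      using zeta_partial_le_ln[OF assms(1), of "Suc n"] by simp
  qed
  also have "(\<lambda>n. 1 + ln (real (Suc n))) \<in> O(\<lambda>n. real n powr e)"
    using assms(2) by real_asymp
  finally show ?thesis .
qed

lemma summable_bigo_powr_over_Suc_power:
  fixes f :: "nat \<Rightarrow> real"
  assumes "f \<in> O(\<lambda>n. real n powr e)" "e < 1" "q \<ge> 2"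
  shows "summable (\<lambda>n. f n / real (Suc n) ^ q)"
proof (rule summable_comparison_test_bigo)
  show "summable (\<lambda>n. norm (real n powr (e - 2)))"
    using assms(2) by (simp add: summable_real_powr_iff)
  have "(\<lambda>n. 1 / real (Suc n) ^ q) \<in> O(\<lambda>n. 1 / real (Suc n) ^ 2)"
    using assms(3)
    by (intro landau_o.big_mono always_eventually)
      (auto intro!: divide_left_mono power_increasing simp del: of_nat_Suc)
  also have "(\<lambda>n. 1 / real (Suc n) ^ 2) \<in> O(\<lambda>n. real n powr -2)"
    by real_asymp
  finally have "(\<lambda>n. f n * (1 / real (Suc n) ^ q)) \<in> O(\<lambda>n. real n powr e * real n powr -2)"
    by (rule landau_o.big.mult[OF assms(1)])
  thus "(\<lambda>n. f n / real (Suc n) ^ q) \<in> O(\<lambda>n. real n powr (e - 2))"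
    by (simp add: powr_add[symmetric])
qed

lemma euler_sum1_sums:
  assumes "a \<ge> 1" "q \<ge> 2"
  shows "(\<lambda>n. zeta_partial (Suc n) a / real (Suc n) ^ q) sums euler_sum1 a q"
  unfolding euler_sum1_def
  by (intro summable_sums summable_bigo_powr_over_Suc_power[OF zeta_partial_bigo[of a "1 / 2"]])
    (use assms in auto)

lemma euler_sum2_sums:
  assumes "a \<ge> 1" "b \<ge> 1" "q \<ge> 2"
  shows "(\<lambda>n. zeta_partial (Suc n) a * zeta_partial (Suc n) b / real (Suc n) ^ q)
    sums euler_sum2 a b q"
proof -
  have "(\<lambda>n. zeta_partial (Suc n) a * zeta_partial (Suc n) b)
      \<in> O(\<lambda>n. real n powr (1 / 4) * real n powr (1 / 4))"
    using assms by (intro landau_o.big.mult zeta_partial_bigo) auto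
  hence "(\<lambda>n. zeta_partial (Suc n) a * zeta_partial (Suc n) b) \<in> O(\<lambda>n. real n powr (1 / 2))"
    by (simp add: powr_add[symmetric])
  thus ?thesis
    unfolding euler_sum2_def using assms(3)
    by (intro summable_sums summable_bigo_powr_over_Suc_power) auto
qed

lemma euler_sum1_reflection:
  assumes "a \<ge> 2" "b \<ge> 2"
  shows "euler_sum1 a b + euler_sum1 b a = zeta a * zeta b + zeta (a + b)"
proof (rule LIMSEQ_unique)
  let ?partial = "\<lambda>N. (\<Sum>n<N. zeta_partial (Suc n) a / real (Suc n) ^ b)
    + (\<Sum>n<N. zeta_partial (Suc n) b / real (Suc n) ^ a)"
  show "?partial \<longlonglongrightarrow> euler_sum1 a b + euler_sum1 b a"
    using euler_sum1_sums[of a b] euler_sum1_sums[of b a] assms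
    by (intro tendsto_add) (simp_all add: sums_def)
  have "?partial N = (\<Sum>n<N. 1 / real (Suc n) ^ a) * (\<Sum>n<N. 1 / real (Suc n) ^ b)
      + (\<Sum>n<N. 1 / real (Suc n) ^ (a + b))" for N
    using sum_partial_sums_reflection[of "\<lambda>n. 1 / real (Suc n) ^ a" "\<lambda>n. 1 / real (Suc n) ^ b" N]
    by (simp add: zeta_partial_altdef lessThan_Suc_atMost power_add del: of_nat_Suc)
  moreover have "(\<lambda>N. (\<Sum>n<N. 1 / real (Suc n) ^ a) * (\<Sum>n<N. 1 / real (Suc n) ^ b)
      + (\<Sum>n<N. 1 / real (Suc n) ^ (a + b))) \<longlonglongrightarrow> zeta a * zeta b + zeta (a + b)"
    using assms by (intro tendsto_intros zeta_sums[unfolded sums_def]) auto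
  ultimately show "?partial \<longlonglongrightarrow> zeta a * zeta b + zeta (a + b)"
    by presburger
qed

lemma partial_fractions_power_times_shifted_square:
  fixes x y :: "'a::field"
  assumes nonzero: "x \<noteq> 0" "y \<noteq> 0" "x + y \<noteq> 0"
  shows "1 / (x ^ a * (x + y)\<^sup>2) =
     (\<Sum>s = 2..a. (-1) ^ s * of_nat (s - 1) / (y ^ s * x ^ (a + 2 - s)))
     + (-1) ^ a / (y ^ a * (x + y)\<^sup>2)
     - (-1) ^ a * of_nat a / y ^ (a + 1) * (1 / x - 1 / (x + y))"
proof (induction a)
  case (Suc a)
  define power_part
    where "power_part = (\<Sum>s = 2..a. (-1) ^ s * of_nat (s - 1) / (y ^ s * x ^ (a + 2 - s)))"
  define coeff where "coeff = (-1) ^ a / y ^ a"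
  define pole_diff where "pole_diff = 1 / x - 1 / (x + y)"
  have square_over_x: "1 / x * (1 / (x + y)\<^sup>2) = 1 / y\<^sup>2 * pole_diff - 1 / (y * (x + y)\<^sup>2)"
    using nonzero by (simp add: pole_diff_def divide_simps) algebra
  have pole_diff_over_x: "1 / x * pole_diff = 1 / x\<^sup>2 - 1 / y * pole_diff"
    using nonzero by (simp add: pole_diff_def divide_simps) algebra
  have power_part_Suc:
    "(\<Sum>s = 2..Suc a. (-1) ^ s * of_nat (s - 1) / (y ^ s * x ^ (Suc a + 2 - s)))
      = 1 / x * power_part - coeff * of_nat a / y * (1 / x\<^sup>2)"
  proof -
    have "(\<Sum>s = 2..a. (-1) ^ s * of_nat (s - 1) / (y ^ s * x ^ (Suc a + 2 - s)))
        = 1 / x * power_part"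
      unfolding power_part_def sum_distrib_left by (intro sum.cong) (auto simp: Suc_diff_le)
    thus ?thesis
      by (cases "a = 0") (simp_all add: coeff_def mult_ac power2_eq_square)
  qed
  have "1 / (x ^ Suc a * (x + y)\<^sup>2) = 1 / x * (1 / (x ^ a * (x + y)\<^sup>2))" by simp
  also have "\<dots> = 1 / x * (power_part + coeff * (1 / (x + y)\<^sup>2) - coeff * of_nat a / y * pole_diff)"
    using Suc.IH by (simp add: power_part_def coeff_def pole_diff_def mult_ac)
  also have "\<dots> = 1 / x * power_part + coeff * (1 / x * (1 / (x + y)\<^sup>2))
      - coeff * of_nat a / y * (1 / x * pole_diff)"
    by (simp only: algebra_simps)
  also have "\<dots> = (1 / x * power_part - coeff * of_nat a / y * (1 / x\<^sup>2)) - coeff / y * (1 / (x + y)\<^sup>2)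
      + coeff * of_nat (Suc a) / y\<^sup>2 * pole_diff"
    unfolding square_over_x pole_diff_over_x
    by (simp add: algebra_simps power2_eq_square add_divide_distrib diff_divide_distrib)
  finally show ?case
    unfolding power_part_Suc by (simp add: coeff_def pole_diff_def power2_eq_square mult_ac)
qed simp

definition shifted_zeta :: "nat \<Rightarrow> nat \<Rightarrow> real" where
  "shifted_zeta a n = (\<Sum>k. 1 / (real (Suc k) ^ a * (real (Suc k) + real n)\<^sup>2))"

lemma shifted_zeta_summable:
  "summable (\<lambda>k. 1 / (real (Suc k) ^ a * (real (Suc k) + real n)\<^sup>2))"
proof (rule summable_comparison_test')
  show "summable (\<lambda>k. 1 / (real (Suc k) + real n)\<^sup>2)"
    using zeta_tail_sums[of 2 n] by (simp add: sums_iff)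
  show "norm (1 / (real (Suc k) ^ a * (real (Suc k) + real n)\<^sup>2)) \<le> 1 / (real (Suc k) + real n)\<^sup>2" for k
    by (auto simp: field_simps intro!: mult_left_mono one_le_power)
qed

lemma shifted_zeta_eq:
  assumes "n > 0"
  shows "shifted_zeta a n =
     (\<Sum>s = 2..a. (-1) ^ s * real (s - 1) / real n ^ s * zeta (a + 2 - s))
     + (-1) ^ a / real n ^ a * (zeta 2 - zeta_partial n 2)
     - (-1) ^ a * real a / real n ^ (a + 1) * zeta_partial n 1"
proof -
  have expansion: "1 / (real (Suc k) ^ a * (real (Suc k) + real n)\<^sup>2) =
      (\<Sum>s = 2..a. (-1) ^ s * real (s - 1) / real n ^ s * (1 / real (Suc k) ^ (a + 2 - s)))
      + (-1) ^ a / real n ^ a * (1 / (real (Suc k) + real n)\<^sup>2)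
      - (-1) ^ a * real a / real n ^ (a + 1) * (1 / real (Suc k) - 1 / (real (Suc k) + real n))" for k
    using assms by (subst partial_fractions_power_times_shifted_square) simp_all
  show ?thesis
    unfolding shifted_zeta_def expansion
    by (intro sums_unique[symmetric] sums_add sums_diff sums_sum sums_mult
        harmonic_telescope_sums zeta_tail_sums zeta_sums) auto
qed

lemma zeta_partial_times_shifted_zeta_sums:
  assumes "a \<ge> 1" "b \<ge> 2"
  shows "(\<lambda>n. zeta_partial (Suc n) a * shifted_zeta b (Suc n)) sums
    ((\<Sum>s = 2..b. real (s - 1) * ((-1) ^ s * zeta (b + 2 - s) * euler_sum1 a s))
    + (-1) ^ b * (zeta 2 * euler_sum1 a b - euler_sum2 2 a b)
    - (-1) ^ b * real b * euler_sum2 1 a (b + 1))"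
proof -
  have expansion: "zeta_partial (Suc n) a * shifted_zeta b (Suc n) =
      (\<Sum>s = 2..b. real (s - 1) * ((-1) ^ s * zeta (b + 2 - s)
        * (zeta_partial (Suc n) a / real (Suc n) ^ s)))
      + (-1) ^ b * (zeta 2 * (zeta_partial (Suc n) a / real (Suc n) ^ b)
        - zeta_partial (Suc n) 2 * zeta_partial (Suc n) a / real (Suc n) ^ b)
      - (-1) ^ b * real b
        * (zeta_partial (Suc n) 1 * zeta_partial (Suc n) a / real (Suc n) ^ (b + 1))" for n
    by (simp add: shifted_zeta_eq ring_distribs sum_distrib_left diff_divide_distrib mult_ac
        del: of_nat_Suc power_Suc)
  show ?thesis
    unfolding expansion using assms
    by (intro sums_add sums_diff sums_sum sums_mult euler_sum1_sums euler_sum2_sums) auto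
qed

definition shifted_euler_sum :: "nat \<Rightarrow> nat \<Rightarrow> real" where
  "shifted_euler_sum a b = (\<Sum>n. zeta_partial (Suc n) a * shifted_zeta b (Suc n))"

lemma shifted_euler_sum_eq:
  assumes "a \<ge> 1" "b \<ge> 2"
  shows "shifted_euler_sum a b =
    (\<Sum>i = 1..b - 1. \<Sum>j = 1..b - i. (-1) ^ (i + j) * zeta (b + 2 - i - j) * euler_sum1 a (i + j))
    + (-1) ^ b * (zeta 2 * euler_sum1 a b - euler_sum2 2 a b)
    - (-1) ^ b * real b * euler_sum2 1 a (b + 1)"
proof -
  have "(\<Sum>i = 1..b - 1. \<Sum>j = 1..b - i. (-1) ^ (i + j) * zeta (b + 2 - i - j) * euler_sum1 a (i + j))
      = (\<Sum>s = 2..b. real (s - 1) * ((-1) ^ s * zeta (b + 2 - s) * euler_sum1 a s))"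
    using sum_triangle_by_diagonals[of "\<lambda>s. (-1) ^ s * zeta (b + 2 - s) * euler_sum1 a s" b]
    by (simp only: diff_diff_left)
  thus ?thesis
    using zeta_partial_times_shifted_zeta_sums[OF assms]
    by (simp only: shifted_euler_sum_def sums_iff)
qed

lemma shifted_euler_sum_commute:
  assumes "a \<ge> 1" "b \<ge> 2"
  shows "shifted_euler_sum a b = shifted_euler_sum b a"
proof -
  define u where "u s k = 1 / real (Suc k) ^ s" for s k
  \<comment> \<open>Summation indices are one less than the integers they stand for, hence the offset 2.\<close>
  define w where "w N = 1 / (real N + 2)\<^sup>2" for N
  have kernel: "1 / (real (Suc k) ^ s * (real (Suc k) + real (Suc n))\<^sup>2) = u s k * w (n + k)" for s k n
    by (simp add: u_def w_def algebra_simps)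
  have factors: "zeta_partial (Suc n) r * shifted_zeta s (Suc n)
      = (\<Sum>j\<le>n. u r j) * (\<Sum>k. u s k * w (n + k))" for r s n
    by (simp only: zeta_partial_altdef shifted_zeta_def kernel u_def lessThan_Suc_atMost)
  have nonneg: "u s k \<ge> 0" "w N \<ge> 0" for s k N
    by (simp_all add: u_def w_def)
  have summable: "summable (\<lambda>k. u s k * w (n + k))" for s n
    using shifted_zeta_summable[of s "Suc n"] by (simp only: kernel)
  have "(\<lambda>n. zeta_partial (Suc n) a * shifted_zeta b (Suc n)) sums s
      \<longleftrightarrow> (\<lambda>n. zeta_partial (Suc n) b * shifted_zeta a (Suc n)) sums s" for s
    unfolding factors by (intro sums_partial_sum_times_shifted_suminf_swap nonneg summable)
  moreover have "(\<lambda>n. zeta_partial (Suc n) a * shifted_zeta b (Suc n)) sums shifted_euler_sum a b"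
    using zeta_partial_times_shifted_zeta_sums[OF assms]
    by (simp add: shifted_euler_sum_def sums_iff)
  ultimately have "(\<lambda>n. zeta_partial (Suc n) b * shifted_zeta a (Suc n)) sums shifted_euler_sum a b"
    by blast
  thus ?thesis by (simp add: shifted_euler_sum_def sums_iff)
qed

theorem theorem3p1:
  fixes p m :: nat
  assumes "p \<ge> 2"
  shows "(-1) ^ (p - 1) *
           (euler_sum2 2 (p + 2*m + 1) p + euler_sum2 2 p (p + 2*m + 1))
       = (\<Sum>i = 1..p + 2*m. \<Sum>j = 1..p + 2*m + 1 - i.
            (-1) ^ (i + j) * zeta (p + 2*m + 3 - i - j) * euler_sum1 p (i + j))
       - (\<Sum>i = 1..p - 1. \<Sum>j = 1..p - i.
            (-1) ^ (i + j) * zeta (p + 2 - i - j) * euler_sum1 (p + 2*m + 1) (i + j))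
       - (-1) ^ p * zeta 2 * (zeta p * zeta (p + 2*m + 1) + zeta (2*p + 2*m + 1))
       + (-1) ^ p * real (p + 2*m + 1) * euler_sum2 1 p (p + 2*m + 2)
       + (-1) ^ p * real p * euler_sum2 1 (p + 2*m + 1) (p + 1)"
proof -
  define q where "q = p + 2*m + 1"
  have q_ge_2: "q \<ge> 2" and pred_q: "p + 2*m = q - 1"
    and shifted_q: "p + 2*m + 3 = q + 2" "p + 2*m + 2 = q + 1" "2*p + 2*m + 1 = p + q"
    using assms by (auto simp: q_def)
  have signs: "(-1 :: real) ^ q = - ((-1) ^ p)" "(-1 :: real) ^ (p - 1) = - ((-1) ^ p)"
    using assms by (auto simp: q_def power_add uminus_power_if)
  have reflection: "zeta p * zeta q + zeta (p + q) = euler_sum1 p q + euler_sum1 q p"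
    using euler_sum1_reflection[OF assms q_ge_2] by simp
  have "shifted_euler_sum p q = shifted_euler_sum q p"
    using assms q_ge_2 by (intro shifted_euler_sum_commute) simp_all
  thus ?thesis
    unfolding q_def[symmetric] shifted_q unfolding pred_q reflection signs
    using assms q_ge_2 by (simp add: shifted_euler_sum_eq signs) argo
qed

end
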